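(* Let $\mathrm{AG}$ be finite and nonempty, and let $X\in\{\epsilon,\mathtt S,\mathtt D,\mathtt{SD}\}$. Then the class of general concurrent game $X$-frames over $\mathrm{AG}$ is characterized, up to AC-representability, by the class of AC-representative actual neighborhood $X$-frames over $\mathrm{AG}$; that is: (1) every general concurrent game $X$-frame over $\mathrm{AG}$ is AC-representable by some AC-representative actual neighborhood $X$-frame; and (2) for every AC-representative actual neighborhood $X$-frame $\mathcal N$ over $\mathrm{AG}$ there is a general concurrent game $X$-frame over $\mathrm{AG}$ that is AC-representable by $\mathcal N$.
   Context: Let $\mathrm{AG}$ be a finite nonempty set of agents; coalitions are subsets of $\mathrm{AG}$. **Game frames.** Given a nonempty action set $\mathrm{AC}$, $\mathrm{JA}_C$ is the set of functions $C\to\mathrm{AC}$ (so $\mathrm{JA}_\emptyset=\{\emptyset\}$); $\sigma|_C$ denotes restriction. An action frame is $(\mathrm{ST},\mathrm{AC},\{\mathrm{av}_C\}_{C\subseteq\mathrm{AG}},\{\mathrm{out}_C\}_{C\subseteq\mathrm{AG}})$ with $\mathrm{ST}$ and $\mathrm{AC}$ nonempty sets, $\mathrm{av}_C:\mathrm{ST}\to\mathcal P(\mathrm{JA}_C)$ and $\mathrm{out}_C:\mathrm{ST}\times\mathrm{JA}_C\to\mathcal P(\mathrm{ST})$. The action set $\mathrm{AC}$ may vary from frame to frame and need not be finite. It is a general concurrent game frame if for all $C\subseteq\mathrm{AG}$, $s\in\mathrm{ST}$: (GCI) for all $\sigma_C\in\mathrm{JA}_C$, $\mathrm{out}_C(s,\sigma_C)=\bigcup\{\mathrm{out}_{\mathrm{AG}}(s,\sigma)\mid\sigma\in\mathrm{JA}_{\mathrm{AG}},\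 \sigma|_C=\sigma_C\}$; (ODA) $\mathrm{av}_C(s)=\{\sigma_C\in\mathrm{JA}_C\mid\mathrm{out}_C(s,\sigma_C)\neq\emptyset\}$. It is serial ($\mathtt S$) if $\mathrm{av}_C(s)\ne\emptyset$ for all $C,s$; deterministic ($\mathtt D$) if $\mathrm{out}_{\mathrm{AG}}(s,\sigma)$ is a singleton for all $s$ and $\sigma\in\mathrm{av}_{\mathrm{AG}}(s)$. For $X\in\{\epsilon,\mathtt S,\mathtt D,\mathtt{SD}\}$ ($\epsilon$ is the empty string), a general concurrent game $X$-frame is a general concurrent game frame having every property whose symbol occurs in $X$ (the omitted properties are not required to fail). **Actual neighborhood frames and representability.** An actual neighborhood frame is $\mathcal N=(\mathrm{ST},\{N_C\}_{C\subseteq\mathrm{AG}})$ with $\mathrm{ST}$ a nonempty set and $N_C:\mathrm{ST}\to\mathcal P(\mathcal P(\mathrm{ST}))$. An action frame is AC-representable by $\mathcal N$ if both have the same state set and $\{\mathrm{out}_C(s,\sigma_C)\mid\sigma_C\in\mathrm{av}_C(s)\}=N_C(s)$ for all $s\in\mathrm{ST}$, $C\subseteq\mathrm{AG}$. **Profiles.** A power profile at $s$ is a family $\gamma=(\gamma_C)_{C\subseteq\mathrm{AG}}$ with $\gamma_C\in N_C(s)$ for all $C$ and $\gamma_D\subseteq\gamma_C$ whenever $C\subseteq D\subseteq\mathrm{AG}$. $\Gamma_s$ is the set of power profiles at $s$ (possibly empty). For $\gamma,\delta\in\Gamma_s$, $\gamma\equiv^s_C\delta$ means $\gamma_D=\delta_D$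 for every $D\subseteq C$. A set $\Omega\subseteq\Gamma_s$ is coherent if for every $\gamma\in\Omega$ and $C\subseteq\mathrm{AG}$, $\gamma_C=\bigcup\{\delta_{\mathrm{AG}}\mid\delta\in\Omega,\ \delta\equiv^s_C\gamma\}$. A coherent profile cover at $s$ is a coherent $\Omega_s\subseteq\Gamma_s$ with $N_C(s)=\{\gamma_C\mid\gamma\in\Omega_s\}$ for every $C\subseteq\mathrm{AG}$. **AC-representativeness.** $\mathcal N$ is AC-representative if: (1) for every $s$, if $N_\emptyset(s)$ is nonempty then it is a singleton; (2) $\emptyset\notin N_C(s)$ for all $s,C$; (3) for every $s\in\mathrm{ST}$ there exists a (possibly empty) coherent profile cover at $s$. Such an $\mathcal N$ is AC-serial ($\mathtt S$) if $N_C(s)\ne\emptyset$ for all $s,C$, and AC-deterministic ($\mathtt D$) if for every $s$ every element of $N_{\mathrm{AG}}(s)$ is a singleton. An AC-representative actual neighborhood $X$-frame is an AC-representative frame having every AC-property whose symbol occurs in $X$. *)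

theory Defs
  imports Main "HOL-Library.FuncSet"
begin

(* The agent set AG is an explicit carrier. Families indexed by coalitions are
   total functions on 'ag set; only their values at C with C \<subseteq> AG (and, where
   applicable, at s in the state set and at joint actions of C) are meaningful. *)

datatype frame_symbol = Serial | Deterministic

record ('ag, 's, 'act) action_frame =
  ST :: "'s set"
  AC :: "'act set"
  av :: "'ag set \<Rightarrow> 's \<Rightarrow> ('ag \<Rightarrow> 'act) set"
  out :: "'ag set \<Rightarrow> 's \<Rightarrow> ('ag \<Rightarrow> 'act) \<Rightarrow> 's set"

(* Functions C \<rightarrow> AC are extensional: undefined outside C. *)
definition JA :: "('ag, 's, 'act) action_frame \<Rightarrow> 'ag set \<Rightarrow> ('ag \<Rightarrow> 'act) set" where
  "JA F C = (C \<rightarrow>\<^sub>E AC F)"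

definition is_action_frame :: "'ag set \<Rightarrow> ('ag, 's, 'act) action_frame \<Rightarrow> bool" where
  "is_action_frame AG F \<longleftrightarrow>
     ST F \<noteq> {} \<and> AC F \<noteq> {} \<and>
     (\<forall>C\<subseteq>AG. \<forall>s\<in>ST F. av F C s \<subseteq> JA F C) \<and>
     (\<forall>C\<subseteq>AG. \<forall>s\<in>ST F. \<forall>\<sigma>\<in>JA F C. out F C s \<sigma> \<subseteq> ST F)"

definition GCI :: "'ag set \<Rightarrow> ('ag, 's, 'act) action_frame \<Rightarrow> bool" where
  "GCI AG F \<longleftrightarrow>
     (\<forall>C\<subseteq>AG. \<forall>s\<in>ST F. \<forall>\<sigma>\<^sub>C\<in>JA F C.
        out F C s \<sigma>\<^sub>C = \<Union>{out F AG s \<sigma> |\<sigma>. \<sigma> \<in> JA F AG \<and> restrict \<sigma> C = \<sigma>\<^sub>C})"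

definition ODA :: "'ag set \<Rightarrow> ('ag, 's, 'act) action_frame \<Rightarrow> bool" where
  "ODA AG F \<longleftrightarrow>
     (\<forall>C\<subseteq>AG. \<forall>s\<in>ST F. av F C s = {\<sigma>\<^sub>C \<in> JA F C. out F C s \<sigma>\<^sub>C \<noteq> {}})"

definition frame_serial :: "'ag set \<Rightarrow> ('ag, 's, 'act) action_frame \<Rightarrow> bool" where
  "frame_serial AG F \<longleftrightarrow> (\<forall>C\<subseteq>AG. \<forall>s\<in>ST F. av F C s \<noteq> {})"

definition frame_deterministic :: "'ag set \<Rightarrow> ('ag, 's, 'act) action_frame \<Rightarrow> bool" where
  "frame_deterministic AG F \<longleftrightarrow>
     (\<forall>s\<in>ST F. \<forall>\<sigma>\<in>av F AG s. is_singleton (out F AG s \<sigma>))"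

definition general_concurrent_game_frame ::
  "'ag set \<Rightarrow> frame_symbol set \<Rightarrow> ('ag, 's, 'act) action_frame \<Rightarrow> bool" where
  "general_concurrent_game_frame AG X F \<longleftrightarrow>
     is_action_frame AG F \<and> GCI AG F \<and> ODA AG F \<and>
     (Serial \<in> X \<longrightarrow> frame_serial AG F) \<and>
     (Deterministic \<in> X \<longrightarrow> frame_deterministic AG F)"

record ('ag, 's) nbhd_frame =
  NST :: "'s set"
  Nb :: "'ag set \<Rightarrow> 's \<Rightarrow> 's set set"

definition is_nbhd_frame :: "'ag set \<Rightarrow> ('ag, 's) nbhd_frame \<Rightarrow> bool" where
  "is_nbhd_frame AG N \<longleftrightarrow>
     NST N \<noteq> {} \<and> (\<forall>C\<subseteq>AG. \<forall>s\<in>NST N. Nb N C s \<subseteq> Pow (NST N))"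

definition AC_representable ::
  "'ag set \<Rightarrow> ('ag, 's, 'act) action_frame \<Rightarrow> ('ag, 's) nbhd_frame \<Rightarrow> bool" where
  "AC_representable AG F N \<longleftrightarrow>
     ST F = NST N \<and>
     (\<forall>s\<in>ST F. \<forall>C\<subseteq>AG. {out F C s \<sigma>\<^sub>C |\<sigma>\<^sub>C. \<sigma>\<^sub>C \<in> av F C s} = Nb N C s)"

type_synonym ('ag, 's) profile = "'ag set \<Rightarrow> 's set"

definition power_profiles ::
  "'ag set \<Rightarrow> ('ag, 's) nbhd_frame \<Rightarrow> 's \<Rightarrow> ('ag, 's) profile set" where
  "power_profiles AG N s =
     {\<gamma> \<in> (\<Pi>\<^sub>E C\<in>Pow AG. Nb N C s). \<forall>C D. C \<subseteq> D \<and> D \<subseteq> AG \<longrightarrow> \<gamma> D \<subseteq> \<gamma> C}"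

definition profile_equiv ::
  "'ag set \<Rightarrow> ('ag, 's) profile \<Rightarrow> ('ag, 's) profile \<Rightarrow> bool" where
  "profile_equiv C \<gamma> \<delta> \<longleftrightarrow> (\<forall>D\<subseteq>C. \<gamma> D = \<delta> D)"

definition coherent ::
  "'ag set \<Rightarrow> ('ag, 's) nbhd_frame \<Rightarrow> 's \<Rightarrow> ('ag, 's) profile set \<Rightarrow> bool" where
  "coherent AG N s \<Omega> \<longleftrightarrow>
     \<Omega> \<subseteq> power_profiles AG N s \<and>
     (\<forall>\<gamma>\<in>\<Omega>. \<forall>C\<subseteq>AG. \<gamma> C = \<Union>{\<delta> AG |\<delta>. \<delta> \<in> \<Omega> \<and> profile_equiv C \<delta> \<gamma>})"

definition coherent_profile_cover ::
  "'ag set \<Rightarrow> ('ag, 's) nbhd_frame \<Rightarrow> 's \<Rightarrow> ('ag, 's) profile set \<Rightarrow> bool" where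
  "coherent_profile_cover AG N s \<Omega> \<longleftrightarrow>
     coherent AG N s \<Omega> \<and> (\<forall>C\<subseteq>AG. Nb N C s = {\<gamma> C |\<gamma>. \<gamma> \<in> \<Omega>})"

definition AC_representative :: "'ag set \<Rightarrow> ('ag, 's) nbhd_frame \<Rightarrow> bool" where
  "AC_representative AG N \<longleftrightarrow>
     (\<forall>s\<in>NST N. Nb N {} s \<noteq> {} \<longrightarrow> is_singleton (Nb N {} s)) \<and>
     (\<forall>s\<in>NST N. \<forall>C\<subseteq>AG. {} \<notin> Nb N C s) \<and>
     (\<forall>s\<in>NST N. \<exists>\<Omega>. coherent_profile_cover AG N s \<Omega>)"

definition AC_serial :: "'ag set \<Rightarrow> ('ag, 's) nbhd_frame \<Rightarrow> bool" where
  "AC_serial AG N \<longleftrightarrow> (\<forall>s\<in>NST N. \<forall>C\<subseteq>AG. Nb N C s \<noteq> {})"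

definition AC_deterministic :: "'ag set \<Rightarrow> ('ag, 's) nbhd_frame \<Rightarrow> bool" where
  "AC_deterministic AG N \<longleftrightarrow> (\<forall>s\<in>NST N. \<forall>Y\<in>Nb N AG s. is_singleton Y)"

definition AC_representative_frame ::
  "'ag set \<Rightarrow> frame_symbol set \<Rightarrow> ('ag, 's) nbhd_frame \<Rightarrow> bool" where
  "AC_representative_frame AG X N \<longleftrightarrow>
     is_nbhd_frame AG N \<and> AC_representative AG N \<and>
     (Serial \<in> X \<longrightarrow> AC_serial AG N) \<and>
     (Deterministic \<in> X \<longrightarrow> AC_deterministic AG N)"

(* HOL cannot quantify existentially over types, so an existential statement about
   game frames with an arbitrary action set has to name a type from which that set
   is drawn. ('ag, 's) profile is a large enough choice: it depends only on the
   types of agents and states, and the action set AC remains part of the frame. *)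
type_synonym ('ag, 's) witness_frame = "('ag, 's, ('ag, 's) profile) action_frame"

end

(* From a game frame, each available joint action sigma of AG yields the power profile
   C |-> out_C(s, sigma|C), and these profiles form a coherent cover.

   Conversely, fix a coherent cover Omega_s at every state. The frame to be built must let a
   coalition C fix the values gamma_D for D \<subseteq> C of a profile gamma, and nothing more. This is
   secret sharing: every agent i submits for every coalition D a share, a set of states, and the
   value of D is the symmetric difference of the shares for D submitted by the members of D. The
   members of C determine the values of all D \<subseteq> C, while for D not contained in C any member of
   D outside C can still steer the value of D to an arbitrary set. The outcome is gamma_AG if the
   values are those of some gamma in Omega_s, and empty otherwise; coherence then says that the
   outcome of C is gamma_C. The empty coalition shares nothing, and it need not, because
   N_{}(s) has at most one element. *)
theory Submission
  imports Defs
begin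

section \<open>Representability as an equality of images\<close>

lemma AC_representable_iff_image:
  "AC_representable AG F N \<longleftrightarrow>
    ST F = NST N \<and> (\<forall>s\<in>ST F. \<forall>C\<subseteq>AG. Nb N C s = out F C s ` av F C s)"
  unfolding AC_representable_def Setcompr_eq_image eq_commute[of "_ ` _"] ..

text \<open>An image is empty exactly when its domain is. Together with the analogue for
  determinism, this handles every choice of \<open>X\<close> in both halves of the theorem.\<close>

lemma AC_representable_serial_iff:
  "AC_representable AG F N \<Longrightarrow> frame_serial AG F \<longleftrightarrow> AC_serial AG N"
  by (auto simp: AC_representable_iff_image frame_serial_def AC_serial_def)

lemma AC_representable_deterministic_iff:
  "AC_representable AG F N \<Longrightarrow> frame_deterministic AG F \<longleftrightarrow> AC_deterministic AG N"
  by (auto simp: AC_representable_iff_image frame_deterministic_def AC_deterministic_def)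

section \<open>From game frames to neighborhood frames\<close>

definition induced_nbhd :: "('ag, 's, 'act) action_frame \<Rightarrow> ('ag, 's) nbhd_frame" where
  "induced_nbhd F = \<lparr>NST = ST F, Nb = \<lambda>C s. out F C s ` av F C s\<rparr>"

text \<open>The profile is cut off outside \<open>Pow AG\<close> because
  \<open>power_profiles\<close> consists of extensional functions.\<close>

definition action_profile ::
  "'ag set \<Rightarrow> ('ag, 's, 'act) action_frame \<Rightarrow> 's \<Rightarrow> ('ag \<Rightarrow> 'act) \<Rightarrow> ('ag, 's) profile" where
  "action_profile AG F s \<sigma> = (\<lambda>C\<in>Pow AG. out F C s (restrict \<sigma> C))"

lemma AC_representable_induced_nbhd: "AC_representable AG F (induced_nbhd F)"
  by (simp add: AC_representable_iff_image induced_nbhd_def)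

lemma JA_restrict: "\<sigma> \<in> JA F D \<Longrightarrow> C \<subseteq> D \<Longrightarrow> restrict \<sigma> C \<in> JA F C"
  by (auto simp: JA_def)

lemma GCI_mem_iff:
  assumes "GCI AG F" "C \<subseteq> AG" "s \<in> ST F" "\<sigma> \<in> JA F C"
  shows "x \<in> out F C s \<sigma> \<longleftrightarrow>
    (\<exists>\<tau>. \<tau> \<in> JA F AG \<and> restrict \<tau> C = \<sigma> \<and> x \<in> out F AG s \<tau>)"
proof -
  have "out F C s \<sigma> = \<Union>{out F AG s \<tau> |\<tau>. \<tau> \<in> JA F AG \<and> restrict \<tau> C = \<sigma>}"
    using assms unfolding GCI_def by blast
  then show ?thesis by auto
qed

text \<open>A joint action of \<open>AG\<close> that agrees with \<open>\<sigma>\<close> on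
  \<open>D\<close> also agrees with it on \<open>C\<close>, so the union given by \<open>GCI\<close>
  for \<open>C\<close> has at least the members of the one for \<open>D\<close>.\<close>

lemma GCI_antimono:
  assumes "GCI AG F" "C \<subseteq> D" "D \<subseteq> AG" "s \<in> ST F" "\<sigma> \<in> JA F AG"
  shows "out F D s (restrict \<sigma> D) \<subseteq> out F C s (restrict \<sigma> C)"
proof
  fix x assume "x \<in> out F D s (restrict \<sigma> D)"
  then obtain \<tau> where \<tau>: "\<tau> \<in> JA F AG" "restrict \<tau> D = restrict \<sigma> D" "x \<in> out F AG s \<tau>"
    using GCI_mem_iff[OF assms(1,3,4) JA_restrict[OF assms(5,3)]] by blast
  have "restrict \<tau> C = restrict \<sigma> C"
    using \<tau>(2) assms(2) by (metis inf.absorb_iff2 restrict_restrict)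
  then show "x \<in> out F C s (restrict \<sigma> C)"
    using GCI_mem_iff[OF assms(1) _ assms(4) JA_restrict[OF assms(5)]] \<tau> assms(2,3) by blast
qed

lemma av_iff: "ODA AG F \<Longrightarrow> C \<subseteq> AG \<Longrightarrow> s \<in> ST F \<Longrightarrow>
    \<sigma> \<in> av F C s \<longleftrightarrow> \<sigma> \<in> JA F C \<and> out F C s \<sigma> \<noteq> {}"
  by (simp add: ODA_def)

lemma JA_restrict_self: "\<sigma> \<in> JA F C \<Longrightarrow> restrict \<sigma> C = \<sigma>"
  by (simp add: JA_def)

lemma av_restrict:
  assumes "GCI AG F" "ODA AG F" "C \<subseteq> AG" "s \<in> ST F" "\<sigma> \<in> av F AG s"
  shows "restrict \<sigma> C \<in> av F C s"
proof -
  have "\<sigma> \<in> JA F AG" "out F AG s \<sigma> \<noteq> {}"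
    using assms by (auto simp: av_iff)
  then show ?thesis
    using GCI_antimono[OF assms(1,3) order_refl assms(4)] JA_restrict[of \<sigma> F AG C] assms
    by (auto simp: av_iff JA_restrict_self)
qed

text \<open>A point of the outcome of \<open>C\<close> under \<open>\<sigma>\<close> comes from a
  full joint action \<open>\<tau>\<close> agreeing with \<open>\<sigma>\<close> on \<open>C\<close>,
  and then the two profiles agree at every subset of \<open>C\<close>. Conversely, the value at
  \<open>AG\<close> of an equivalent profile lies inside its value at \<open>C\<close>, which is
  \<open>\<gamma> C\<close>.\<close>

lemma coherent_action_profiles:
  assumes "GCI AG F" "ODA AG F" "s \<in> ST F"
  shows "coherent AG (induced_nbhd F) s (action_profile AG F s ` av F AG s)"
  unfolding coherent_def
proof (intro conjI ballI allI impI)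
  show "action_profile AG F s ` av F AG s \<subseteq> power_profiles AG (induced_nbhd F) s"
  proof (rule image_subsetI)
    fix \<sigma> assume \<sigma>: "\<sigma> \<in> av F AG s"
    then have "\<sigma> \<in> JA F AG" using assms by (simp add: av_iff)
    then show "action_profile AG F s \<sigma> \<in> power_profiles AG (induced_nbhd F) s"
      using GCI_antimono[OF assms(1) _ _ assms(3), of _ _ \<sigma>]
        av_restrict[OF assms(1,2) _ assms(3) \<sigma>]
      by (auto simp: power_profiles_def action_profile_def induced_nbhd_def)
  qed
next
  fix \<gamma> C assume "\<gamma> \<in> action_profile AG F s ` av F AG s" and C: "C \<subseteq> AG"
  then obtain \<sigma> where \<sigma>: "\<sigma> \<in> av F AG s" and \<gamma>: "\<gamma> = action_profile AG F s \<sigma>"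
    by auto
  have \<sigma>_JA: "\<sigma> \<in> JA F AG" using assms \<sigma> by (simp add: av_iff)
  show "\<gamma> C = \<Union>{\<delta> AG |\<delta>. \<delta> \<in> action_profile AG F s ` av F AG s \<and> profile_equiv C \<delta> \<gamma>}"
    (is "_ = \<Union>?\<Delta>")
  proof
    show "\<gamma> C \<subseteq> \<Union>?\<Delta>"
    proof
      fix x assume "x \<in> \<gamma> C"
      then have "x \<in> out F C s (restrict \<sigma> C)"
        using C by (simp add: \<gamma> action_profile_def)
      then obtain \<tau> where \<tau>: "\<tau> \<in> JA F AG" "restrict \<tau> C = restrict \<sigma> C" "x \<in> out F AG s \<tau>"
        using GCI_mem_iff[OF assms(1) C assms(3) JA_restrict[OF \<sigma>_JA C]] by blast
      have "restrict \<tau> D = restrict \<sigma> D" if "D \<subseteq> C" for D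
        using \<tau>(2) that by (metis inf.absorb_iff2 restrict_restrict)
      then have "profile_equiv C (action_profile AG F s \<tau>) \<gamma>"
        using C by (auto simp: profile_equiv_def \<gamma> action_profile_def)
      moreover have "\<tau> \<in> av F AG s" using \<tau> assms by (auto simp: av_iff)
      moreover have "x \<in> action_profile AG F s \<tau> AG"
        using \<tau> by (simp add: action_profile_def JA_restrict_self)
      ultimately show "x \<in> \<Union>?\<Delta>" by blast
    qed
  next
    show "\<Union>?\<Delta> \<subseteq> \<gamma> C"
    proof clarify
      fix x \<tau> assume \<tau>: "\<tau> \<in> av F AG s" "profile_equiv C (action_profile AG F s \<tau>) \<gamma>"
        and x: "x \<in> action_profile AG F s \<tau> AG"
      have "\<tau> \<in> JA F AG" using \<tau> assms by (simp add: av_iff)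
      then have "x \<in> action_profile AG F s \<tau> C"
        using GCI_antimono[OF assms(1) C order_refl assms(3)] x C
        by (auto simp: action_profile_def)
      then show "x \<in> \<gamma> C" using \<tau>(2) by (simp add: profile_equiv_def)
    qed
  qed
qed

lemma coherent_profile_cover_induced_nbhd:
  assumes "GCI AG F" "ODA AG F" "s \<in> ST F"
  shows "coherent_profile_cover AG (induced_nbhd F) s (action_profile AG F s ` av F AG s)"
proof -
  have "Nb (induced_nbhd F) C s = {\<gamma> C |\<gamma>. \<gamma> \<in> action_profile AG F s ` av F AG s}"
    if C: "C \<subseteq> AG" for C
  proof
    show "Nb (induced_nbhd F) C s \<subseteq> {\<gamma> C |\<gamma>. \<gamma> \<in> action_profile AG F s ` av F AG s}"
    proof
      fix Y assume "Y \<in> Nb (induced_nbhd F) C s"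
      then obtain \<sigma> where "\<sigma> \<in> av F C s" and Y: "Y = out F C s \<sigma>"
        by (auto simp: induced_nbhd_def)
      then have \<sigma>: "\<sigma> \<in> JA F C" "out F C s \<sigma> \<noteq> {}"
        using assms C by (auto simp: av_iff)
      \<comment> \<open>By \<open>GCI\<close>, a nonempty outcome of \<open>C\<close> forces a
        nonempty outcome of some full joint action extending \<open>\<sigma>\<close>; its profile
        has the value \<open>Y\<close> at \<open>C\<close>.\<close>
      then obtain \<tau> where \<tau>: "\<tau> \<in> JA F AG" "restrict \<tau> C = \<sigma>" "out F AG s \<tau> \<noteq> {}"
        using GCI_mem_iff[OF assms(1) C assms(3) \<sigma>(1)] by blast
      then have "\<tau> \<in> av F AG s" "Y = action_profile AG F s \<tau> C"
        using assms C Y by (auto simp: av_iff action_profile_def)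
      then show "Y \<in> {\<gamma> C |\<gamma>. \<gamma> \<in> action_profile AG F s ` av F AG s}" by blast
    qed
    show "{\<gamma> C |\<gamma>. \<gamma> \<in> action_profile AG F s ` av F AG s} \<subseteq> Nb (induced_nbhd F) C s"
      using C av_restrict[OF assms(1,2) C assms(3)]
      by (auto simp: induced_nbhd_def action_profile_def)
  qed
  then show ?thesis
    using coherent_action_profiles[OF assms] by (simp add: coherent_profile_cover_def)
qed

lemma AC_representative_frame_induced_nbhd:
  assumes "general_concurrent_game_frame AG X F"
  shows "AC_representative_frame AG X (induced_nbhd F)"
proof -
  have F: "is_action_frame AG F" "GCI AG F" "ODA AG F"
    using assms by (auto simp: general_concurrent_game_frame_def)
  have "out F C s \<sigma> \<subseteq> ST F" if "C \<subseteq> AG" "s \<in> ST F" "\<sigma> \<in> av F C s" for C s \<sigma>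
    using F(1,3) that by (simp add: is_action_frame_def av_iff)
  then have "is_nbhd_frame AG (induced_nbhd F)"
    using F(1) by (simp add: is_nbhd_frame_def induced_nbhd_def is_action_frame_def image_subset_iff)
  moreover have "AC_representative AG (induced_nbhd F)"
    unfolding AC_representative_def
  proof (intro conjI ballI allI impI)
    fix s assume s: "s \<in> NST (induced_nbhd F)" "Nb (induced_nbhd F) {} s \<noteq> {}"
    \<comment> \<open>The empty coalition has a single joint action, the everywhere undefined
      one.\<close>
    then have "av F {} s \<noteq> {}" "av F {} s \<subseteq> {\<lambda>_. undefined}"
      using F(3) by (auto simp: induced_nbhd_def av_iff JA_def)
    then have "av F {} s = {\<lambda>_. undefined}" by blast
    then show "is_singleton (Nb (induced_nbhd F) {} s)"
      by (simp add: induced_nbhd_def)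
  next
    fix s C assume "s \<in> NST (induced_nbhd F)" "C \<subseteq> AG"
    then show "{} \<notin> Nb (induced_nbhd F) C s"
      using F(3) by (auto simp: induced_nbhd_def av_iff)
  next
    fix s assume "s \<in> NST (induced_nbhd F)"
    then show "\<exists>\<Omega>. coherent_profile_cover AG (induced_nbhd F) s \<Omega>"
      using coherent_profile_cover_induced_nbhd[OF F(2,3)] by (auto simp: induced_nbhd_def)
  qed
  ultimately show ?thesis
    using assms AC_representable_induced_nbhd[of AG F]
    by (auto simp: AC_representative_frame_def general_concurrent_game_frame_def
        AC_representable_serial_iff AC_representable_deterministic_iff)
qed

section \<open>From neighborhood frames to game frames\<close>

definition shared_value :: "('ag \<Rightarrow> ('ag, 's) profile) \<Rightarrow> ('ag, 's) profile" where
  "shared_value \<sigma> D = {x. odd (card {i \<in> D. x \<in> \<sigma> i D})}"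

text \<open>The empty coalition is exempt: its shared value is always the empty set, whereas
  neighborhoods in a representative frame are nonempty.\<close>

definition encodes ::
  "'ag set \<Rightarrow> ('ag \<Rightarrow> ('ag, 's) profile) \<Rightarrow> ('ag, 's) profile \<Rightarrow> bool" where
  "encodes C \<sigma> \<gamma> \<longleftrightarrow> (\<forall>D\<subseteq>C. D \<noteq> {} \<longrightarrow> shared_value \<sigma> D = \<gamma> D)"

text \<open>An action is a whole profile, one share per coalition. The outcome of each
  \<open>C\<close> is given directly by what \<open>C\<close> encodes, so \<open>ODA\<close> holds
  by construction and \<open>GCI\<close> becomes a statement about extending partial
  encodings.\<close>

definition sharing_frame ::
  "'ag set \<Rightarrow> 's set \<Rightarrow> ('s \<Rightarrow> ('ag, 's) profile set) \<Rightarrow> ('ag, 's) witness_frame" where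
  "sharing_frame AG S \<Omega> =
     (let outc = \<lambda>C s \<sigma>. \<Union>{\<gamma> AG |\<gamma>. \<gamma> \<in> \<Omega> s \<and> encodes C \<sigma> \<gamma>}
      in \<lparr>ST = S, AC = UNIV, av = \<lambda>C s. {\<sigma> \<in> C \<rightarrow>\<^sub>E UNIV. outc C s \<sigma> \<noteq> {}}, out = outc\<rparr>)"

lemma sharing_frame_simps [simp]:
  "ST (sharing_frame AG S \<Omega>) = S"
  "AC (sharing_frame AG S \<Omega>) = UNIV"
  "JA (sharing_frame AG S \<Omega>) C = C \<rightarrow>\<^sub>E UNIV"
  "out (sharing_frame AG S \<Omega>) C s \<sigma> = \<Union>{\<gamma> AG |\<gamma>. \<gamma> \<in> \<Omega> s \<and> encodes C \<sigma> \<gamma>}"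
  "av (sharing_frame AG S \<Omega>) C s =
     {\<sigma> \<in> C \<rightarrow>\<^sub>E UNIV. out (sharing_frame AG S \<Omega>) C s \<sigma> \<noteq> {}}"
  by (simp_all add: sharing_frame_def JA_def)

section \<open>Encoding profiles by shares\<close>

lemma shared_value_cong:
  "(\<And>i. i \<in> D \<Longrightarrow> \<sigma> i D = \<tau> i D) \<Longrightarrow> shared_value \<sigma> D = shared_value \<tau> D"
  unfolding shared_value_def by (metis (mono_tags, lifting) Collect_cong)

lemma encodes_restrict: "encodes C (restrict \<sigma> C) \<gamma> \<longleftrightarrow> encodes C \<sigma> \<gamma>"
proof -
  have "shared_value (restrict \<sigma> C) D = shared_value \<sigma> D" if "D \<subseteq> C" for D
    using that by (intro shared_value_cong) auto
  then show ?thesis by (simp add: encodes_def)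
qed

lemma encodes_subset: "encodes D \<sigma> \<gamma> \<Longrightarrow> C \<subseteq> D \<Longrightarrow> encodes C \<sigma> \<gamma>"
  by (auto simp: encodes_def)

text \<open>The share of \<open>j\<close> corrects the parity left by the members of
  \<open>D\<close> in \<open>C\<close>; the remaining members of \<open>D\<close> submit the empty
  set and add nothing to the count.\<close>

lemma shared_value_steer:
  fixes \<sigma> :: "'ag \<Rightarrow> ('ag, 's) profile"
  assumes "finite D" "j \<in> D" "j \<notin> C"
    and in_C: "\<And>i. i \<in> D \<inter> C \<Longrightarrow> \<tau> i D = \<sigma> i D"
    and at_j: "\<tau> j D = {x. (x \<in> Y) \<noteq> odd (card {i \<in> D \<inter> C. x \<in> \<sigma> i D})}"
    and other: "\<And>i. i \<in> D - C - {j} \<Longrightarrow> \<tau> i D = {}"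
  shows "shared_value \<tau> D = Y"
proof -
  have "odd (card {i \<in> D. x \<in> \<tau> i D}) \<longleftrightarrow> x \<in> Y" for x
  proof -
    let ?A = "{i \<in> D \<inter> C. x \<in> \<sigma> i D}"
    have "{i \<in> D. x \<in> \<tau> i D} = (if x \<in> \<tau> j D then insert j ?A else ?A)"
      using assms(2,3) in_C other by (auto; metis Diff_iff IntI empty_iff singletonD)
    moreover have "finite ?A" "j \<notin> ?A" using assms(1,3) by auto
    ultimately show ?thesis using at_j by auto
  qed
  then show ?thesis by (simp add: shared_value_def)
qed

text \<open>Each coalition has its own component in an action, so for every \<open>D\<close> not
  inside \<open>C\<close> a member outside \<open>C\<close> can correct the value at
  \<open>D\<close> without disturbing the other coalitions. This gives the substantial inclusion of
  \<open>GCI\<close>.\<close>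

lemma encodes_extend:
  fixes \<sigma> :: "'ag \<Rightarrow> ('ag, 's) profile"
  assumes "finite AG" "C \<subseteq> AG" "\<sigma> \<in> C \<rightarrow>\<^sub>E UNIV" "encodes C \<sigma> \<gamma>"
  obtains \<tau> where "\<tau> \<in> AG \<rightarrow>\<^sub>E UNIV" "restrict \<tau> C = \<sigma>" "encodes AG \<tau> \<gamma>"
proof -
  \<comment> \<open>The agent \<open>j D\<close> is the one who corrects the value at
    \<open>D\<close>.\<close>
  have "\<forall>D. \<exists>i. \<not> D \<subseteq> C \<longrightarrow> i \<in> D - C" by blast
  then obtain j where j: "\<And>D. \<not> D \<subseteq> C \<Longrightarrow> j D \<in> D - C" by metis
  define \<tau> where "\<tau> = (\<lambda>i\<in>AG. if i \<in> C then \<sigma> i else (\<lambda>D. if i = j D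
      then {x. (x \<in> \<gamma> D) \<noteq> odd (card {i \<in> D \<inter> C. x \<in> \<sigma> i D})} else {}))"
  have restr: "restrict \<tau> C = \<sigma>"
    using assms(2,3) by (auto simp: \<tau>_def fun_eq_iff PiE_def extensional_def)
  have "shared_value \<tau> D = \<gamma> D" if D: "D \<subseteq> AG" "D \<noteq> {}" for D
  proof (cases "D \<subseteq> C")
    case True
    then show ?thesis
      using assms(4) D(2) encodes_restrict[of C \<tau> \<gamma>] by (simp add: restr encodes_def)
  next
    case False
    have "j D \<in> D" "j D \<notin> C" using j[OF False] by auto
    moreover from this have "j D \<in> AG" using D(1) by blast
    moreover have "finite D" using D(1) assms(1) by (rule finite_subset)
    moreover have "i \<in> AG" if "i \<in> D" for i using D(1) that by blast
    ultimately show ?thesis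
      by (intro shared_value_steer[of D "j D" C \<tau> \<sigma> "\<gamma> D"]) (simp_all add: \<tau>_def)
  qed
  then show thesis
    using that[of \<tau>] restr by (auto simp: encodes_def \<tau>_def)
qed

section \<open>The sharing frame as a game frame represented by \<open>N\<close>\<close>

lemma GCI_sharing_frame:
  assumes "finite AG"
  shows "GCI AG (sharing_frame AG S \<Omega>)"
  unfolding GCI_def
proof (intro allI impI ballI)
  fix C s \<sigma>
  assume C: "C \<subseteq> AG" and \<sigma>: "\<sigma> \<in> JA (sharing_frame AG S \<Omega>) C"
  let ?out = "out (sharing_frame AG S \<Omega>)"
  let ?R = "\<Union>{?out AG s \<tau> |\<tau>. \<tau> \<in> JA (sharing_frame AG S \<Omega>) AG \<and> restrict \<tau> C = \<sigma>}"
  show "?out C s \<sigma> = ?R"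
  proof
    show "?out C s \<sigma> \<subseteq> ?R"
    proof
      fix x assume "x \<in> ?out C s \<sigma>"
      then obtain \<gamma> where \<gamma>: "\<gamma> \<in> \<Omega> s" "encodes C \<sigma> \<gamma>" "x \<in> \<gamma> AG" by auto
      obtain \<tau> where "\<tau> \<in> AG \<rightarrow>\<^sub>E UNIV" "restrict \<tau> C = \<sigma>" "encodes AG \<tau> \<gamma>"
        using encodes_extend[OF assms C _ \<gamma>(2)] \<sigma> by auto
      then have "\<tau> \<in> JA (sharing_frame AG S \<Omega>) AG" "restrict \<tau> C = \<sigma>" "x \<in> ?out AG s \<tau>"
        using \<gamma> by auto
      then show "x \<in> ?R" by blast
    qed
    have "encodes C \<sigma> \<gamma>" if "encodes AG \<tau> \<gamma>" "restrict \<tau> C = \<sigma>" for \<tau> \<gamma>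
      using that C encodes_restrict encodes_subset by metis
    then show "?R \<subseteq> ?out C s \<sigma>" unfolding sharing_frame_simps by blast
  qed
qed

text \<open>Once \<open>\<sigma>\<close> encodes \<open>\<gamma>\<close> on \<open>C\<close>, the
  profiles of the cover that it encodes are exactly those equivalent to \<open>\<gamma>\<close> up
  to \<open>C\<close>; coherence evaluates the union of their values at \<open>AG\<close>.\<close>

lemma coherent_out_sharing_frame:
  assumes coh: "coherent AG N s (\<Omega> s)"
    and sing: "Nb N {} s \<noteq> {} \<longrightarrow> is_singleton (Nb N {} s)"
    and C: "C \<subseteq> AG" and \<gamma>: "\<gamma> \<in> \<Omega> s" "encodes C \<sigma> \<gamma>"
  shows "out (sharing_frame AG S \<Omega>) C s \<sigma> = \<gamma> C"
proof -
  \<comment> \<open>Shares say nothing about the empty coalition, but it has at most one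
    neighborhood, so all profiles of the cover agree there.\<close>
  have "\<delta> {} = \<gamma> {}" if "\<delta> \<in> \<Omega> s" for \<delta>
  proof -
    have "\<delta> {} \<in> Nb N {} s" "\<gamma> {} \<in> Nb N {} s"
      using coh that \<gamma>(1) by (auto simp: coherent_def power_profiles_def)
    then show ?thesis using sing by (metis empty_iff is_singletonE singletonD)
  qed
  then have "encodes C \<sigma> \<delta> \<longleftrightarrow> profile_equiv C \<delta> \<gamma>" if "\<delta> \<in> \<Omega> s" for \<delta>
    using \<gamma>(2) that unfolding encodes_def profile_equiv_def by metis
  then have "out (sharing_frame AG S \<Omega>) C s \<sigma> =
      \<Union>{\<delta> AG |\<delta>. \<delta> \<in> \<Omega> s \<and> profile_equiv C \<delta> \<gamma>}"
    by auto
  also have "\<dots> = \<gamma> C"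
    using coh C \<gamma>(1) by (simp add: coherent_def)
  finally show ?thesis .
qed

lemma AC_representable_sharing_frame:
  assumes "finite AG" "AC_representative AG N"
    and cover: "\<And>s. s \<in> NST N \<Longrightarrow> coherent_profile_cover AG N s (\<Omega> s)"
  shows "AC_representable AG (sharing_frame AG (NST N) \<Omega>) N"
proof -
  let ?F = "sharing_frame AG (NST N) \<Omega>"
  have "out ?F C s ` av ?F C s = Nb N C s" if s: "s \<in> NST N" and C: "C \<subseteq> AG" for s C
  proof -
    have coh: "coherent AG N s (\<Omega> s)" and Nb: "Nb N C s = (\<lambda>\<gamma>. \<gamma> C) ` \<Omega> s"
      using cover[OF s] C by (auto simp: coherent_profile_cover_def)
    have sing: "Nb N {} s \<noteq> {} \<longrightarrow> is_singleton (Nb N {} s)" and ne: "{} \<notin> Nb N C s"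
      using assms(2) s C by (auto simp: AC_representative_def)
    note out_eq = coherent_out_sharing_frame[of AG N s \<Omega>, OF coh sing C]
    show ?thesis
    proof
      show "out ?F C s ` av ?F C s \<subseteq> Nb N C s"
      proof (rule image_subsetI)
        fix \<sigma> assume "\<sigma> \<in> av ?F C s"
        then obtain \<gamma> where "\<gamma> \<in> \<Omega> s" "encodes C \<sigma> \<gamma>" by auto
        then show "out ?F C s \<sigma> \<in> Nb N C s"
          using out_eq Nb by auto
      qed
      show "Nb N C s \<subseteq> out ?F C s ` av ?F C s"
      proof
        fix Y assume Y: "Y \<in> Nb N C s"
        then have "Y \<noteq> {}" using ne by blast
        obtain \<gamma> where \<gamma>: "\<gamma> \<in> \<Omega> s" "Y = \<gamma> C" using Y Nb by blast
        \<comment> \<open>The joint action of the empty coalition encodes every profile vacuously;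
          extending it to \<open>AG\<close> yields an encoding of all of \<open>\<gamma>\<close>,
          which is then restricted to \<open>C\<close>.\<close>
        have "encodes {} (\<lambda>_. undefined) \<gamma>" by (simp add: encodes_def)
        then obtain \<tau> where "encodes AG \<tau> \<gamma>"
          by (rule encodes_extend[OF assms(1) empty_subsetI, rotated]) simp_all
        then have "encodes C (restrict \<tau> C) \<gamma>"
          using C by (simp add: encodes_restrict encodes_subset)
        then have "out ?F C s (restrict \<tau> C) = Y"
          using out_eq \<gamma> by simp
        \<comment> \<open>Availability means a nonempty outcome, which is where the exclusion of
          empty neighborhoods enters.\<close>
        moreover from this have "restrict \<tau> C \<in> av ?F C s"
          using \<open>Y \<noteq> {}\<close> by (simp del: sharing_frame_simps(4))
        ultimately show "Y \<in> out ?F C s ` av ?F C s" by blast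
      qed
    qed
  qed
  then show ?thesis
    by (simp add: AC_representable_iff_image del: sharing_frame_simps(4,5))
qed

text \<open>Seriality and determinism are inherited from \<open>N\<close> through
  representability.\<close>

lemma general_concurrent_game_frame_sharing_frame:
  assumes "finite AG" "AC_representative_frame AG X N"
    and cover: "\<And>s. s \<in> NST N \<Longrightarrow> coherent_profile_cover AG N s (\<Omega> s)"
  shows "general_concurrent_game_frame AG X (sharing_frame AG (NST N) \<Omega>)"
proof -
  let ?F = "sharing_frame AG (NST N) \<Omega>"
  have N: "is_nbhd_frame AG N" "AC_representative AG N"
    using assms(2) by (auto simp: AC_representative_frame_def)
  have "\<gamma> AG \<subseteq> NST N" if "s \<in> NST N" "\<gamma> \<in> \<Omega> s" for s \<gamma>
    using N(1) cover that unfolding is_nbhd_frame_def coherent_profile_cover_def by blast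
  then have "is_action_frame AG ?F"
    using N(1) by (auto simp: is_action_frame_def is_nbhd_frame_def)
  moreover have "ODA AG ?F" by (auto simp: ODA_def)
  ultimately show ?thesis
    using GCI_sharing_frame[OF assms(1)] assms(2)
      AC_representable_sharing_frame[OF assms(1) N(2) cover]
    by (auto simp: general_concurrent_game_frame_def AC_representative_frame_def
        AC_representable_serial_iff AC_representable_deterministic_iff)
qed

theorem corollary1:
  fixes AG :: "'ag set" and X :: "frame_symbol set"
  assumes "finite AG" and "AG \<noteq> {}"
  shows
    "(\<forall>F :: ('ag, 's, 'act) action_frame.
        general_concurrent_game_frame AG X F \<longrightarrow>
        (\<exists>N :: ('ag, 's) nbhd_frame.
           AC_representative_frame AG X N \<and> AC_representable AG F N)) \<and>
     (\<forall>N :: ('ag, 's) nbhd_frame.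
        AC_representative_frame AG X N \<longrightarrow>
        (\<exists>F :: ('ag, 's) witness_frame.
           general_concurrent_game_frame AG X F \<and> AC_representable AG F N))"
proof (intro conjI allI impI)
  fix F :: "('ag, 's, 'act) action_frame"
  assume "general_concurrent_game_frame AG X F"
  then show "\<exists>N :: ('ag, 's) nbhd_frame. AC_representative_frame AG X N \<and> AC_representable AG F N"
    using AC_representative_frame_induced_nbhd AC_representable_induced_nbhd by blast
next
  fix N :: "('ag, 's) nbhd_frame"
  assume N: "AC_representative_frame AG X N"
  then have "\<forall>s\<in>NST N. \<exists>\<Omega>. coherent_profile_cover AG N s \<Omega>"
    by (simp add: AC_representative_frame_def AC_representative_def)
  then obtain \<Omega> where "\<And>s. s \<in> NST N \<Longrightarrow> coherent_profile_cover AG N s (\<Omega> s)"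
    by metis
  then show "\<exists>F :: ('ag, 's) witness_frame.
      general_concurrent_game_frame AG X F \<and> AC_representable AG F N"
    using general_concurrent_game_frame_sharing_frame[OF assms(1) N]
      AC_representable_sharing_frame[OF assms(1)] N
    unfolding AC_representative_frame_def by blast
qed

end
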